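(* Let $\Phi={}^t(\Phi_1,\dots,\Phi_d)$ and $\Omega={}^t(\Omega_1,\dots,\Omega_d)$, with $\Phi_j={}^t(\phi_{j,1},\phi_{j,2})$, $\Omega_j={}^t(\omega_{j,1},\omega_{j,2})\in\mathbb{C}^2$, be unit vectors in $\mathbb{C}^{2d}$ such that (a) $\Phi_j\cdot(\sigma_1\Omega_j)=0$ for all $j\in\{1,\dots,d\}$, and (b) $\langle\Phi_l,\sigma_+\Omega_l\rangle_{\mathbb{C}^2}\neq0$ for some $l\in\{1,\dots,d\}$, which we fix. Let $(\bm p,\bm q)\in D_l$ and let $\mathfrak{f}:[-1,1]\setminus\sigma(T_0)\to\mathbb{R}$ be the function $$\mathfrak{f}(\lambda)=\lambda-a_\Omega(\bm p)+\langle\varphi_{\bm q},(T_0-\lambda)^{-1}\varphi_{\bm q}\rangle_{\ell^2(\mathbb{Z}^d)}$$ (see context). Then: (1) $\mathfrak{f}$ has a zero $\lambda_\star\in\mathbb{T}_-:=[-1,-\lambda(\bm q)+a_\Phi(\bm p))$ if $$\lambda(\bm q)\bigl(\lambda(\bm q)+a_\Omega(\bm p)-a_\Phi(\bm p)\bigr)<\|\varphi_{\bm q}\|^2\leq(1+a_\Omega(\bm p))\,\frac{(1+a_\Phi(\bm p))^2-\lambda(\bm q)^2}{1+a_\Phi(\bm p)};$$ (2) $\mathfrak{f}$ has a zero $\lambda_\star\in\mathbb{T}_+:=(\lambda(\bm q)+a_\Phi(\bm p),1]$ if $$\lambda(\bm q)\bigl(\lambda(\bm q)-a_\Omega(\bm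 p)+a_\Phi(\bm p)\bigr)<\|\varphi_{\bm q}\|^2\leq(1-a_\Omega(\bm p))\,\frac{(1-a_\Phi(\bm p))^2-\lambda(\bm q)^2}{1-a_\Phi(\bm p)}.$$
   Context: Inner products $\langle\cdot,\cdot\rangle$ are conjugate-linear in the first argument; ${}^*$ on scalars is complex conjugation. For $\Psi={}^t(\psi_1,\psi_2),\Phi={}^t(\phi_1,\phi_2)\in\mathbb{C}^2$, $\Psi\cdot\Phi=\psi_1\phi_1+\psi_2\phi_2$ (bilinear, no conjugation). Matrices: $\sigma_1=\begin{pmatrix}0&1\\1&0\end{pmatrix}$, $\sigma_+=\begin{pmatrix}0&1\\0&0\end{pmatrix}$, $\sigma_3=\begin{pmatrix}1&0\\0&-1\end{pmatrix}$. $d\ge1$ is an integer; $D=\{(\bm p,\bm q)\in\mathbb{R}^d\times\mathbb{C}^d: p_j^2+|q_j|^2=1,\ j=1,\dots,d\}$ and $D_l=\{(\bm p,\bm q)\in D: p_lq_l\neq0\}$. $\{\bm e_j\}_{j=1}^d$ is the standard basis of $\mathbb{Z}^d$, and $\mathbbm{1}_{A}$ denotes the characteristic function of $A\subset\mathbb{Z}^d$. $a_\Omega(\bm p)=\sum_{j=1}^dp_j\langle\Omega_j,\sigma_3\Omega_j\rangle_{\mathbb{C}^2}$, $a_\Phi(\bm p)=\sum_{j=1}^dp_j\langle\Phi_j,\sigma_3\Phi_j\rangle_{\mathbb{C}^2}$, $\alpha_j=q_j\phi_{j,1}^*\phi_{j,2}$, $\lambda(\bm q)=2\sum_{j=1}^d|\alpha_j|$.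 On $\ell^2(\mathbb{Z}^d)$, $(L_jf)(\bm x)=f(\bm x+\bm e_j)$ and $T_0=a_\Phi(\bm p)+\sum_{j=1}^d(\alpha_jL_j+\alpha_j^*L_j^* )$, a bounded self-adjoint operator with $\sigma(T_0)=[a_\Phi(\bm p)-\lambda(\bm q),a_\Phi(\bm p)+\lambda(\bm q)]$. $\varphi_{\bm q}=\sum_{j=1}^d\bigl(q_j\omega_{j,2}\phi_{j,1}^*\mathbbm{1}_{\{-\bm e_j\}}+q_j^*\omega_{j,1}\phi_{j,2}^*\mathbbm{1}_{\{\bm e_j\}}\bigr)\in\ell^2(\mathbb{Z}^d)$. Under the hypotheses, $a_\Phi(\bm p)\neq\pm1$, so the right-hand sides make sense. *)

theory Defs
  imports "HOL-Analysis.Analysis"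
begin

section \<open>Finite-dimensional data\<close>

text \<open>
  The coordinates \<open>1, \<dots>, d\<close> are the elements of a finite index type \<open>'d\<close>, so that
  \<open>d = CARD('d) \<ge> 1\<close>, and \<open>\<int>\<^sup>d\<close> is the type \<^typ>\<open>int ^ 'd\<close>.  An element of \<open>\<complex>\<^sup>2\<^sup>d\<close>, given as a column of
  \<open>d\<close> vectors in \<open>\<complex>\<^sup>2\<close>, has type \<^typ>\<open>complex ^ 2 ^ 'd\<close>; the library norm of that type is the
  Euclidean norm of \<open>\<complex>\<^sup>2\<^sup>d\<close>.
\<close>

definition vec_inner :: "complex ^ 'n \<Rightarrow> complex ^ 'n \<Rightarrow> complex" where
  "vec_inner u v = (\<Sum>i\<in>UNIV. cnj (u $ i) * v $ i)"

definition vec_dot :: "complex ^ 'n \<Rightarrow> complex ^ 'n \<Rightarrow> complex" where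
  "vec_dot u v = (\<Sum>i\<in>UNIV. u $ i * v $ i)"

definition sigma1 :: "complex ^ 2 ^ 2" where
  "sigma1 = vector [vector [0, 1], vector [1, 0]]"

definition sigma_plus :: "complex ^ 2 ^ 2" where
  "sigma_plus = vector [vector [0, 1], vector [0, 0]]"

definition sigma3 :: "complex ^ 2 ^ 2" where
  "sigma3 = vector [vector [1, 0], vector [0, -1]]"

definition param_set :: "((real ^ 'd) \<times> (complex ^ 'd)) set" where
  "param_set = {(p, q). \<forall>j. (p $ j)\<^sup>2 + (cmod (q $ j))\<^sup>2 = 1}"

definition param_set_at :: "'d \<Rightarrow> ((real ^ 'd) \<times> (complex ^ 'd)) set" where
  "param_set_at l = {(p, q). (p, q) \<in> param_set \<and> complex_of_real (p $ l) * q $ l \<noteq> 0}"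

text \<open>
  \<open>a_val p \<Omega>\<close> and \<open>a_val p \<Phi>\<close> are \<open>a\<^sub>\<Omega>(p)\<close> and \<open>a\<^sub>\<Phi>(p)\<close>.  Taking the real part only turns a real
  complex number into an element of \<^typ>\<open>real\<close>, see \<open>of_real_a_val\<close>.
\<close>

definition a_val :: "real ^ 'd \<Rightarrow> complex ^ 2 ^ 'd \<Rightarrow> real" where
  "a_val p V = (\<Sum>j\<in>UNIV. p $ j * Re (vec_inner (V $ j) (sigma3 *v (V $ j))))"

lemma of_real_a_val:
  "complex_of_real (a_val p V) =
     (\<Sum>j\<in>UNIV. complex_of_real (p $ j) * vec_inner (V $ j) (sigma3 *v (V $ j)))"
proof -
  have "vec_inner u (sigma3 *v u) = complex_of_real (Re (vec_inner u (sigma3 *v u)))" for u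
    by (simp add: complex_eq_iff vec_inner_def sigma3_def matrix_vector_mult_def sum_2 vector_2)
  then show ?thesis
    by (simp add: a_val_def)
qed

definition alpha :: "complex ^ 'd \<Rightarrow> complex ^ 2 ^ 'd \<Rightarrow> 'd \<Rightarrow> complex" where
  "alpha q \<Phi> j = q $ j * cnj (\<Phi> $ j $ 1) * \<Phi> $ j $ 2"

definition lambda_val :: "complex ^ 'd \<Rightarrow> complex ^ 2 ^ 'd \<Rightarrow> real" where
  "lambda_val q \<Phi> = 2 * (\<Sum>j\<in>UNIV. cmod (alpha q \<Phi> j))"


section \<open>Square-summable functions and operators on them\<close>

definition ell2 :: "('a \<Rightarrow> complex) set" where
  "ell2 = {f. (\<lambda>x. (cmod (f x))\<^sup>2) summable_on UNIV}"

definition ell2_inner :: "('a \<Rightarrow> complex) \<Rightarrow> ('a \<Rightarrow> complex) \<Rightarrow> complex" where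
  "ell2_inner f g = (\<Sum>\<^sub>\<infinity>x. cnj (f x) * g x)"

definition ell2_norm :: "('a \<Rightarrow> complex) \<Rightarrow> real" where
  "ell2_norm f = sqrt (\<Sum>\<^sub>\<infinity>x. (cmod (f x))\<^sup>2)"

text \<open>
  An operator on \<open>\<ell>\<^sup>2\<close> is a map on all functions of which only the restriction to \<^term>\<open>ell2\<close> matters.
\<close>

definition ell2_adjoint ::
    "(('a \<Rightarrow> complex) \<Rightarrow> ('a \<Rightarrow> complex)) \<Rightarrow> ('a \<Rightarrow> complex) \<Rightarrow> ('a \<Rightarrow> complex)" where
  "ell2_adjoint A f =
     (THE h. h \<in> ell2 \<and> (\<forall>g\<in>ell2. ell2_inner h g = ell2_inner f (A g)))"

definition shifted_op ::
    "(('a \<Rightarrow> complex) \<Rightarrow> ('a \<Rightarrow> complex)) \<Rightarrow> complex \<Rightarrow> ('a \<Rightarrow> complex) \<Rightarrow> ('a \<Rightarrow> complex)" where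
  "shifted_op A z f = (\<lambda>x. A f x - z * f x)"

definition ell2_resolvent ::
    "(('a \<Rightarrow> complex) \<Rightarrow> ('a \<Rightarrow> complex)) \<Rightarrow> complex \<Rightarrow> ('a \<Rightarrow> complex) \<Rightarrow> ('a \<Rightarrow> complex)" where
  "ell2_resolvent A z = inv_into ell2 (shifted_op A z)"

definition ell2_spectrum :: "(('a \<Rightarrow> complex) \<Rightarrow> ('a \<Rightarrow> complex)) \<Rightarrow> complex set" where
  "ell2_spectrum A =
     {z. \<not> (bij_betw (shifted_op A z) ell2 ell2 \<and>
            (\<exists>C. \<forall>f\<in>ell2. ell2_norm (ell2_resolvent A z f) \<le> C * ell2_norm f))}"

lemma ell2_summable_inner:
  assumes "f \<in> ell2" "g \<in> ell2"
  shows "(\<lambda>x. cnj (f x) * g x) summable_on UNIV"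
proof -
  have "(\<lambda>x. norm (cnj (f x) * g x)) summable_on UNIV"
    by (rule Infinite_Sum.abs_summable_product)
      (use assms in \<open>simp_all add: ell2_def norm_mult power2_eq_square\<close>)
  then show ?thesis by (rule Infinite_Sum.abs_summable_summable)
qed

lemma ell2_cmult:
  assumes "f \<in> ell2"
  shows "(\<lambda>x. c * f x) \<in> ell2"
  using assms by (auto simp: ell2_def norm_mult power_mult_distrib intro: summable_on_cmult_right)

lemma ell2_add:
  assumes "f \<in> ell2" "g \<in> ell2"
  shows "(\<lambda>x. f x + g x) \<in> ell2"
proof -
  have sum: "(\<lambda>x. 2 * ((cmod (f x))\<^sup>2 + (cmod (g x))\<^sup>2)) summable_on UNIV"
    using assms by (intro summable_on_cmult_right summable_on_add) (auto simp: ell2_def)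
  have le: "norm ((cmod (f x + g x))\<^sup>2) \<le> 2 * ((cmod (f x))\<^sup>2 + (cmod (g x))\<^sup>2)" for x
  proof -
    have "(cmod (f x + g x))\<^sup>2 \<le> (cmod (f x) + cmod (g x))\<^sup>2"
      by (intro power_mono norm_triangle_ineq) simp
    also have "\<dots> \<le> 2 * ((cmod (f x))\<^sup>2 + (cmod (g x))\<^sup>2)"
      using sum_squares_bound[of "cmod (f x)" "cmod (g x)"] by (simp add: power2_sum)
    finally show ?thesis by simp
  qed
  have "(\<lambda>x. norm ((cmod (f x + g x))\<^sup>2)) summable_on UNIV"
    using sum le by (rule Infinite_Sum.abs_summable_on_comparison_test')
  then show ?thesis by (simp add: ell2_def)
qed

lemma ell2_sum:
  assumes "finite J" "\<And>j. j \<in> J \<Longrightarrow> F j \<in> ell2"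
  shows "(\<lambda>x. \<Sum>j\<in>J. F j x) \<in> ell2"
  using assms
proof (induction J rule: finite_induct)
  case empty
  then show ?case by (simp add: ell2_def)
next
  case (insert j J)
  then show ?case using ell2_add[of "F j" "\<lambda>x. \<Sum>j\<in>J. F j x"] by simp
qed

lemma ell2_indicator: "(\<lambda>x. indicator {y} x) \<in> ell2"
proof -
  have "(\<lambda>x. (cmod (indicator {y} x))\<^sup>2) summable_on UNIV \<longleftrightarrow>
        (\<lambda>x. (cmod (indicator {y} x))\<^sup>2) summable_on {y}"
    by (rule summable_on_cong_neutral) auto
  then show ?thesis by (simp add: ell2_def)
qed

lemma ell2_inner_indicator: "ell2_inner h (\<lambda>x. indicator {y} x) = cnj (h y)"
proof -
  have "(\<Sum>\<^sub>\<infinity>x. cnj (h x) * indicator {y} x) = (\<Sum>\<^sub>\<infinity>x\<in>{y}. cnj (h x) * indicator {y} x)"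
    by (rule infsum_cong_neutral) auto
  then show ?thesis by (simp add: ell2_inner_def)
qed

lemma ell2_inner_cnj: "ell2_inner g f = cnj (ell2_inner f g)"
  by (simp add: ell2_inner_def mult.commute flip: infsum_cnj)

lemma ell2_inner_cmult_right: "ell2_inner f (\<lambda>x. c * g x) = c * ell2_inner f g"
  by (simp add: ell2_inner_def mult.left_commute infsum_cmult_right')

lemma ell2_inner_add_right:
  assumes "f \<in> ell2" "g \<in> ell2" "h \<in> ell2"
  shows "ell2_inner f (\<lambda>x. g x + h x) = ell2_inner f g + ell2_inner f h"
  using infsum_add[OF ell2_summable_inner[OF assms(1,2)] ell2_summable_inner[OF assms(1,3)]]
  by (simp add: ell2_inner_def distrib_left)

lemma ell2_inner_sum_right:
  assumes "finite J" "f \<in> ell2" "\<And>j. j \<in> J \<Longrightarrow> F j \<in> ell2"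
  shows "ell2_inner f (\<lambda>x. \<Sum>j\<in>J. F j x) = (\<Sum>j\<in>J. ell2_inner f (F j))"
  using assms
proof (induction J rule: finite_induct)
  case empty
  then show ?case by (simp add: ell2_inner_def)
next
  case (insert j J)
  then show ?case
    using ell2_inner_add_right[of f "F j" "\<lambda>x. \<Sum>j\<in>J. F j x"] ell2_sum[of J F] by simp
qed

lemma ell2_adjoint_eq:
  assumes "h \<in> ell2" "\<And>g. g \<in> ell2 \<Longrightarrow> ell2_inner h g = ell2_inner f (A g)"
  shows "ell2_adjoint A f = h"
  unfolding ell2_adjoint_def
proof (rule the_equality)
  show "h \<in> ell2 \<and> (\<forall>g\<in>ell2. ell2_inner h g = ell2_inner f (A g))"
    using assms by blast
next
  fix k assume k: "k \<in> ell2 \<and> (\<forall>g\<in>ell2. ell2_inner k g = ell2_inner f (A g))"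
  show "k = h"
  proof
    fix y
    have "ell2_inner k (\<lambda>x. indicator {y} x) = ell2_inner h (\<lambda>x. indicator {y} x)"
      using k assms ell2_indicator[of y] by metis
    then show "k y = h y"
      by (simp add: ell2_inner_indicator)
  qed
qed


section \<open>The operator \<open>T\<^sub>0\<close> and the function \<open>f\<close>\<close>

definition L_op :: "'d \<Rightarrow> (int ^ 'd \<Rightarrow> complex) \<Rightarrow> (int ^ 'd \<Rightarrow> complex)" where
  "L_op j f = (\<lambda>x. f (x + axis j 1))"

definition T0 ::
    "real ^ 'd \<Rightarrow> complex ^ 'd \<Rightarrow> complex ^ 2 ^ 'd \<Rightarrow>
      (int ^ 'd \<Rightarrow> complex) \<Rightarrow> (int ^ 'd \<Rightarrow> complex)" where
  "T0 p q \<Phi> f = (\<lambda>x. complex_of_real (a_val p \<Phi>) * f x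
     + (\<Sum>j\<in>UNIV. alpha q \<Phi> j * L_op j f x + cnj (alpha q \<Phi> j) * ell2_adjoint (L_op j) f x))"

definition phi_q ::
    "complex ^ 'd \<Rightarrow> complex ^ 2 ^ 'd \<Rightarrow> complex ^ 2 ^ 'd \<Rightarrow> int ^ 'd \<Rightarrow> complex" where
  "phi_q q \<Phi> \<Omega> = (\<lambda>x. \<Sum>j\<in>UNIV.
       q $ j * \<Omega> $ j $ 2 * cnj (\<Phi> $ j $ 1) * indicator {- axis j 1} x
     + cnj (q $ j) * \<Omega> $ j $ 1 * cnj (\<Phi> $ j $ 2) * indicator {axis j 1} x)"

text \<open>
  The function \<open>f\<close> has domain \<open>f_dom p q \<Phi>\<close>.  On that domain the inner product in its definition
  is real, see \<open>of_real_f_fun\<close>, so the real part again loses nothing; outside the domain the value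
  is meaningless.
\<close>

definition f_dom :: "real ^ 'd \<Rightarrow> complex ^ 'd \<Rightarrow> complex ^ 2 ^ 'd \<Rightarrow> real set" where
  "f_dom p q \<Phi> = {t \<in> {-1..1}. complex_of_real t \<notin> ell2_spectrum (T0 p q \<Phi>)}"

definition f_fun ::
    "real ^ 'd \<Rightarrow> complex ^ 'd \<Rightarrow> complex ^ 2 ^ 'd \<Rightarrow> complex ^ 2 ^ 'd \<Rightarrow> real \<Rightarrow> real" where
  "f_fun p q \<Phi> \<Omega> t = t - a_val p \<Omega>
     + Re (ell2_inner (phi_q q \<Phi> \<Omega>)
             (ell2_resolvent (T0 p q \<Phi>) (complex_of_real t) (phi_q q \<Phi> \<Omega>)))"

definition T_minus :: "real ^ 'd \<Rightarrow> complex ^ 'd \<Rightarrow> complex ^ 2 ^ 'd \<Rightarrow> real set" where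
  "T_minus p q \<Phi> = {-1 ..< - lambda_val q \<Phi> + a_val p \<Phi>}"

definition T_plus :: "real ^ 'd \<Rightarrow> complex ^ 'd \<Rightarrow> complex ^ 2 ^ 'd \<Rightarrow> real set" where
  "T_plus p q \<Phi> = {lambda_val q \<Phi> + a_val p \<Phi> <.. 1}"

lemma ell2_translate:
  fixes f :: "'a::ab_group_add \<Rightarrow> complex"
  assumes "f \<in> ell2"
  shows "(\<lambda>x. f (x + v)) \<in> ell2"
proof -
  have "bij_betw (\<lambda>x. x + v) UNIV (UNIV :: 'a set)"
    by (rule bij_betw_byWitness[where f' = "\<lambda>x. x - v"]) auto
  from summable_on_reindex_bij_betw[OF this, of "\<lambda>x. (cmod (f x))\<^sup>2"] assms
  show ?thesis by (simp add: ell2_def)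
qed

lemma ell2_inner_translate:
  fixes f g :: "'a::ab_group_add \<Rightarrow> complex"
  shows "ell2_inner (\<lambda>x. f (x - v)) g = ell2_inner f (\<lambda>x. g (x + v))"
proof -
  have "bij_betw (\<lambda>x. x + v) UNIV (UNIV :: 'a set)"
    by (rule bij_betw_byWitness[where f' = "\<lambda>x. x - v"]) auto
  from infsum_reindex_bij_betw[OF this, of "\<lambda>x. cnj (f (x - v)) * g x"]
  show ?thesis by (simp add: ell2_inner_def)
qed

lemma ell2_adjoint_L_op:
  assumes "f \<in> ell2"
  shows "ell2_adjoint (L_op j) f = (\<lambda>x. f (x - axis j 1))"
proof (rule ell2_adjoint_eq)
  show "(\<lambda>x. f (x - axis j 1)) \<in> ell2"
    using ell2_translate[OF assms, of "- axis j 1"] by simp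
qed (simp add: L_op_def ell2_inner_translate)

lemma T0_apply:
  assumes "f \<in> ell2"
  shows "T0 p q \<Phi> f = (\<lambda>x. complex_of_real (a_val p \<Phi>) * f x
     + (\<Sum>j\<in>UNIV. alpha q \<Phi> j * f (x + axis j 1) + cnj (alpha q \<Phi> j) * f (x - axis j 1)))"
  by (simp add: T0_def L_op_def ell2_adjoint_L_op[OF assms])

lemma ell2_T0:
  assumes "f \<in> ell2"
  shows "T0 p q \<Phi> f \<in> ell2"
  unfolding T0_apply[OF assms]
  using ell2_translate[OF assms] ell2_translate[OF assms, of "- axis j 1" for j]
  by (intro ell2_add ell2_sum ell2_cmult) (auto intro: assms)

lemma T0_symmetric:
  assumes f: "f \<in> ell2"
  shows "cnj (ell2_inner f (T0 p q \<Phi> f)) = ell2_inner f (T0 p q \<Phi> f)"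
proof -
  define e :: "'a \<Rightarrow> int ^ 'a" where "e j = axis j 1" for j
  have l: "(\<lambda>x. f (x + e j)) \<in> ell2" and r: "(\<lambda>x. f (x - e j)) \<in> ell2" for j
    using ell2_translate[OF f, of "e j"] ell2_translate[OF f, of "- e j"] by simp_all
  have "ell2_inner f (T0 p q \<Phi> f) = complex_of_real (a_val p \<Phi>) * ell2_inner f f
     + (\<Sum>j\<in>UNIV. alpha q \<Phi> j * ell2_inner f (\<lambda>x. f (x + e j))
                 + cnj (alpha q \<Phi> j) * ell2_inner f (\<lambda>x. f (x - e j)))"
    unfolding T0_apply[OF f] e_def[symmetric]
    by (simp add: ell2_inner_add_right ell2_inner_sum_right ell2_inner_cmult_right
        ell2_add ell2_sum ell2_cmult f l r)
  moreover have "ell2_inner f (\<lambda>x. f (x - e j)) = cnj (ell2_inner f (\<lambda>x. f (x + e j)))" for j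
    using ell2_inner_translate[of f "e j" f] ell2_inner_cnj[of f "\<lambda>x. f (x - e j)"] by simp
  moreover have "cnj (ell2_inner f f) = ell2_inner f f"
    by (rule ell2_inner_cnj[symmetric])
  ultimately show ?thesis by (simp add: add.commute)
qed

lemma ell2_phi_q: "phi_q q \<Phi> \<Omega> \<in> ell2"
  unfolding phi_q_def by (intro ell2_sum ell2_add ell2_cmult ell2_indicator) simp

lemma of_real_f_fun:
  assumes "t \<in> f_dom p q \<Phi>"
  shows "complex_of_real (f_fun p q \<Phi> \<Omega> t) =
     complex_of_real t - complex_of_real (a_val p \<Omega>)
     + ell2_inner (phi_q q \<Phi> \<Omega>)
         (ell2_resolvent (T0 p q \<Phi>) (complex_of_real t) (phi_q q \<Phi> \<Omega>))"
proof -
  let ?u = "phi_q q \<Phi> \<Omega>" and ?S = "shifted_op (T0 p q \<Phi>) (complex_of_real t)"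
  let ?w = "ell2_resolvent (T0 p q \<Phi>) (complex_of_real t) ?u"
  have bij: "bij_betw ?S ell2 ell2"
    using assms by (simp add: f_dom_def ell2_spectrum_def)
  have w: "?w \<in> ell2" and Sw: "?S ?w = ?u"
    using bij ell2_phi_q[of q \<Phi> \<Omega>] unfolding ell2_resolvent_def bij_betw_def
    by (metis inv_into_into, metis f_inv_into_f)
  have "?u = (\<lambda>x. T0 p q \<Phi> ?w x + (- complex_of_real t) * ?w x)"
    using Sw by (simp add: shifted_op_def)
  then have "ell2_inner ?w ?u =
      ell2_inner ?w (\<lambda>x. T0 p q \<Phi> ?w x + (- complex_of_real t) * ?w x)"
    by (rule arg_cong)
  also have "\<dots> = ell2_inner ?w (T0 p q \<Phi> ?w) + (- complex_of_real t) * ell2_inner ?w ?w"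
    by (simp only: ell2_inner_add_right[OF w ell2_T0[OF w] ell2_cmult[OF w]] ell2_inner_cmult_right)
  finally have "ell2_inner ?w ?u =
      ell2_inner ?w (T0 p q \<Phi> ?w) + (- complex_of_real t) * ell2_inner ?w ?w" .
  then have "cnj (ell2_inner ?w ?u) = ell2_inner ?w ?u"
    using T0_symmetric[OF w, of p q \<Phi>] ell2_inner_cnj[of ?w ?w] by simp
  then have "cnj (ell2_inner ?u ?w) = ell2_inner ?u ?w"
    using ell2_inner_cnj[of ?u ?w] by simp
  then have "complex_of_real (Re (ell2_inner ?u ?w)) = ell2_inner ?u ?w"
    by (simp add: complex_eq_iff)
  then show ?thesis by (simp add: f_fun_def)
qed

end

theory Submission
  imports Defs
begin

text \<open>
  Write \<open>T\<^sub>0 = a\<^sub>\<Phi> + H\<close>.  For real \<open>|s| > \<lambda>(q)\<close> the Neumann series gives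
  \<open>\<langle>\<phi>, (H - s)\<^sup>-\<^sup>1 \<phi>\<rangle> = - S(s)\<close> with \<open>S(s) = \<Sum>\<^sub>n m\<^sub>n s\<^sup>-\<^sup>n\<^sup>-\<^sup>1\<close> and \<open>m\<^sub>n = \<langle>\<phi>, H\<^sup>n \<phi>\<rangle>\<close>.
  As \<open>\<phi>\<close> lives on the odd sublattice and \<open>H\<close> exchanges the two sublattices, \<open>m\<^sub>n\<close> vanishes
  for odd \<open>n\<close>, while \<open>m\<^sub>2\<^sub>k = \<parallel>H\<^sup>k \<phi>\<parallel>\<^sup>2\<close> lies between \<open>0\<close> and \<open>\<lambda>(q)\<^sup>2\<^sup>k \<parallel>\<phi>\<parallel>\<^sup>2\<close>.
  So \<open>S\<close> is odd, and for \<open>s > \<lambda>(q)\<close> it satisfies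
  \<open>\<parallel>\<phi>\<parallel>\<^sup>2 / s \<le> S(s) \<le> \<parallel>\<phi>\<parallel>\<^sup>2 s / (s\<^sup>2 - \<lambda>(q)\<^sup>2)\<close>.  Substituting \<open>t = a\<^sub>\<Phi> \<mp> s\<close>, a zero of the
  function is a solution of \<open>S(s) = s \<pm> (a\<^sub>\<Omega> - a\<^sub>\<Phi>)\<close>; the lower bound decides the sign
  near \<open>s = \<lambda>(q)\<close>, the upper bound the sign at \<open>t = \<mp>1\<close>.
\<close>

section \<open>Norms of square-summable functions\<close>

lemma L2_set_le_ell2_norm:
  assumes "f \<in> ell2" "finite F"
  shows "L2_set (\<lambda>x. cmod (f x)) F \<le> ell2_norm f"
  unfolding L2_set_def ell2_norm_def
  using assms by (intro real_sqrt_le_mono finite_sum_le_infsum) (auto simp: ell2_def)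

text \<open>Both conclusions reduce to finite subsets, where the \<open>L2_set\<close> inequalities
  apply. The empty set already forces \<open>0 \<le> C\<close>.\<close>

lemma ell2_norm_leI:
  assumes "\<And>F. finite F \<Longrightarrow> L2_set (\<lambda>x. cmod (f x)) F \<le> C"
  shows "f \<in> ell2" "ell2_norm f \<le> C"
proof -
  have C: "0 \<le> C"
    using assms[of "{}"] by simp
  have le: "(\<Sum>x\<in>F. (cmod (f x))\<^sup>2) \<le> C\<^sup>2" if "finite F" for F
    using assms[OF that] C unfolding L2_set_def by (simp add: sqrt_le_D)
  have "(\<lambda>x. (cmod (f x))\<^sup>2) summable_on UNIV"
    by (rule nonneg_bdd_above_summable_on) (auto intro!: bdd_aboveI[of _ "C\<^sup>2"] le)
  then show f: "f \<in> ell2"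
    by (simp add: ell2_def)
  have "(\<Sum>\<^sub>\<infinity>x. (cmod (f x))\<^sup>2) \<le> C\<^sup>2"
    using f by (intro infsum_le_finite_sums) (auto simp: ell2_def le)
  then show "ell2_norm f \<le> C"
    using C unfolding ell2_norm_def by (simp add: real_le_lsqrt infsum_nonneg)
qed

lemma ell2_norm_nonneg: "0 \<le> ell2_norm f"
  by (simp add: ell2_norm_def infsum_nonneg)

lemma ell2_inner_self:
  assumes f: "f \<in> ell2"
  shows "ell2_inner f f = complex_of_real ((ell2_norm f)\<^sup>2)"
proof -
  have "ell2_inner f f = (\<Sum>\<^sub>\<infinity>x. complex_of_real ((cmod (f x))\<^sup>2))"
    unfolding ell2_inner_def by (rule infsum_cong) (metis complex_norm_square mult.commute)
  also have "\<dots> = complex_of_real (\<Sum>\<^sub>\<infinity>x. (cmod (f x))\<^sup>2)"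
    using f by (intro infsumI has_sum_of_real has_sum_infsum) (simp add: ell2_def)
  finally show ?thesis
    by (simp add: ell2_norm_def infsum_nonneg)
qed

lemma cmod_le_ell2_norm:
  assumes "f \<in> ell2"
  shows "cmod (f x) \<le> ell2_norm f"
  using L2_set_le_ell2_norm[OF assms, of "{x}"] by simp

lemma ell2_norm_add:
  assumes "f \<in> ell2" "g \<in> ell2"
  shows "ell2_norm (\<lambda>x. f x + g x) \<le> ell2_norm f + ell2_norm g"
proof (rule ell2_norm_leI(2))
  fix F :: "'a set" assume F: "finite F"
  have "L2_set (\<lambda>x. cmod (f x + g x)) F \<le> L2_set (\<lambda>x. cmod (f x) + cmod (g x)) F"
    by (intro L2_set_mono norm_triangle_ineq) auto
  also have "\<dots> \<le> L2_set (\<lambda>x. cmod (f x)) F + L2_set (\<lambda>x. cmod (g x)) F"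
    by (rule L2_set_triangle_ineq)
  also have "\<dots> \<le> ell2_norm f + ell2_norm g"
    by (intro add_mono L2_set_le_ell2_norm assms F)
  finally show "L2_set (\<lambda>x. cmod (f x + g x)) F \<le> ell2_norm f + ell2_norm g" .
qed

lemma ell2_norm_cmult: "ell2_norm (\<lambda>x. c * f x) = cmod c * ell2_norm f"
  by (simp add: ell2_norm_def norm_mult power_mult_distrib infsum_cmult_right' real_sqrt_mult)

lemma ell2_norm_zero [simp]: "ell2_norm (\<lambda>x. 0) = 0"
  by (simp add: ell2_norm_def)

lemma ell2_norm_sum:
  assumes "finite J" "\<And>j. j \<in> J \<Longrightarrow> F j \<in> ell2"
  shows "ell2_norm (\<lambda>x. \<Sum>j\<in>J. F j x) \<le> (\<Sum>j\<in>J. ell2_norm (F j))"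
  using assms
proof (induction J rule: finite_induct)
  case (insert j J)
  then show ?case
    using ell2_norm_add[of "F j" "\<lambda>x. \<Sum>j\<in>J. F j x"] ell2_sum[of J F] by simp
qed simp

lemma ell2_norm_translate:
  fixes f :: "'a::ab_group_add \<Rightarrow> complex"
  shows "ell2_norm (\<lambda>x. f (x + v)) = ell2_norm f"
proof -
  have "bij_betw (\<lambda>x. x + v) UNIV (UNIV :: 'a set)"
    by (rule bij_betw_byWitness[where f' = "\<lambda>x. x - v"]) auto
  from infsum_reindex_bij_betw[OF this, of "\<lambda>x. (cmod (f x))\<^sup>2"]
  show ?thesis by (simp add: ell2_norm_def)
qed

lemma ell2_norm_eq_0:
  assumes "f \<in> ell2" "ell2_norm f = 0"
  shows "f = (\<lambda>x. 0)"
  using cmod_le_ell2_norm[OF assms(1)] assms(2) by auto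

text \<open>Makes the pairing with \<open>phi_q\<close> a finite sum, so that it can be exchanged
  with a series known to converge only pointwise.\<close>

lemma ell2_inner_finite_support:
  assumes "finite F" "\<And>x. x \<notin> F \<Longrightarrow> f x = 0"
  shows "ell2_inner f g = (\<Sum>x\<in>F. cnj (f x) * g x)"
proof -
  have "(\<Sum>\<^sub>\<infinity>x. cnj (f x) * g x) = (\<Sum>\<^sub>\<infinity>x\<in>F. cnj (f x) * g x)"
    by (rule infsum_cong_neutral) (use assms in auto)
  then show ?thesis
    using assms by (simp add: ell2_inner_def)
qed

text \<open>Fatou's lemma replaces the completeness of \<open>\<ell>\<^sup>2\<close>.\<close>

lemma ell2_pointwise_limit:
  assumes lim: "\<And>x. (\<lambda>n. F n x) \<longlonglongrightarrow> f x"
    and F: "\<And>n. F n \<in> ell2" "\<And>n. ell2_norm (F n) \<le> C"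
  shows "f \<in> ell2"
proof (rule ell2_norm_leI(1))
  fix A :: "'a set" assume A: "finite A"
  have "(\<lambda>n. L2_set (\<lambda>x. cmod (F n x)) A) \<longlonglongrightarrow> L2_set (\<lambda>x. cmod (f x)) A"
    unfolding L2_set_def by (intro tendsto_intros lim)
  then show "L2_set (\<lambda>x. cmod (f x)) A \<le> C"
    by (rule LIMSEQ_le_const2) (use L2_set_le_ell2_norm[OF F(1) A] F(2) in \<open>meson order_trans\<close>)
qed


section \<open>The hopping operator and its resolvent\<close>

text \<open>The part of \<open>T0\<close> left after removing the constant
  \<open>a_val p \<Phi>\<close>, for \<open>c = alpha q \<Phi>\<close>, with the adjoint shifts
  written as translations.\<close>

definition hop :: "('d \<Rightarrow> complex) \<Rightarrow> (int ^ 'd \<Rightarrow> complex) \<Rightarrow> (int ^ 'd \<Rightarrow> complex)" where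
  "hop c f = (\<lambda>x. \<Sum>j\<in>UNIV. c j * f (x + axis j 1) + cnj (c j) * f (x - axis j 1))"

definition hop_bound :: "('d::finite \<Rightarrow> complex) \<Rightarrow> real" where
  "hop_bound c = 2 * (\<Sum>j\<in>UNIV. cmod (c j))"

lemma hop_bound_nonneg: "0 \<le> hop_bound c"
  by (simp add: hop_bound_def sum_nonneg)

lemma ell2_translate':
  fixes f :: "'a::ab_group_add \<Rightarrow> complex"
  assumes "f \<in> ell2"
  shows "(\<lambda>x. f (x - v)) \<in> ell2"
  using ell2_translate[OF assms, of "- v"] by simp

lemma ell2_hop:
  assumes "f \<in> ell2"
  shows "hop c f \<in> ell2"
  unfolding hop_def
  by (intro ell2_add ell2_sum ell2_cmult ell2_translate ell2_translate' assms) simp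

text \<open>Translations are isometries, so direction \<open>j\<close> contributes at most
  \<open>2 * cmod (c j)\<close> to the norm.\<close>

lemma ell2_norm_hop:
  assumes f: "f \<in> ell2"
  shows "ell2_norm (hop c f) \<le> hop_bound c * ell2_norm f"
proof -
  have mem: "(\<lambda>x. c j * f (x + axis j 1)) \<in> ell2" "(\<lambda>x. cnj (c j) * f (x - axis j 1)) \<in> ell2" for j
    by (intro ell2_cmult ell2_translate ell2_translate' f)+
  have "ell2_norm (hop c f) \<le>
      (\<Sum>j\<in>UNIV. ell2_norm (\<lambda>x. c j * f (x + axis j 1) + cnj (c j) * f (x - axis j 1)))"
    unfolding hop_def by (intro ell2_norm_sum ell2_add mem) simp
  also have "\<dots> \<le> (\<Sum>j\<in>UNIV. 2 * cmod (c j) * ell2_norm f)"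
  proof (rule sum_mono)
    fix j
    show "ell2_norm (\<lambda>x. c j * f (x + axis j 1) + cnj (c j) * f (x - axis j 1))
        \<le> 2 * cmod (c j) * ell2_norm f"
      using ell2_norm_add[OF mem[of j]] ell2_norm_translate[of f "axis j 1"]
        ell2_norm_translate[of f "- axis j 1"]
      by (simp add: ell2_norm_cmult mult_ac)
  qed
  also have "\<dots> = hop_bound c * ell2_norm f"
    by (simp add: hop_bound_def sum_distrib_left sum_distrib_right)
  finally show ?thesis .
qed

text \<open>The adjoint of a translation is the inverse translation, and the two translations in
  each direction carry conjugate coefficients.\<close>

lemma ell2_inner_hop:
  assumes f: "f \<in> ell2" and g: "g \<in> ell2"
  shows "ell2_inner (hop c f) g = ell2_inner f (hop c g)"
proof -
  note intros = ell2_add ell2_sum ell2_cmult ell2_translate ell2_translate' f g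
  have right: "ell2_inner h (hop c k) = (\<Sum>j\<in>UNIV. c j * ell2_inner h (\<lambda>x. k (x + axis j 1))
      + cnj (c j) * ell2_inner h (\<lambda>x. k (x - axis j 1)))"
    if "h \<in> ell2" "k \<in> ell2" for h k
    unfolding hop_def using that
    by (simp add: ell2_inner_add_right ell2_inner_sum_right ell2_inner_cmult_right intros)
  have plus: "ell2_inner f (\<lambda>x. g (x + v)) = cnj (ell2_inner g (\<lambda>x. f (x - v)))" for v
    using ell2_inner_translate[of f v g] ell2_inner_cnj[of g "\<lambda>x. f (x - v)"] by simp
  have minus: "ell2_inner f (\<lambda>x. g (x - v)) = cnj (ell2_inner g (\<lambda>x. f (x + v)))" for v
    using ell2_inner_translate[of g v f] ell2_inner_cnj[of f "\<lambda>x. g (x - v)"] by simp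
  have "ell2_inner f (hop c g) = cnj (ell2_inner g (hop c f))"
    unfolding right[OF f g] right[OF g f] by (simp add: plus minus add.commute)
  then show ?thesis
    using ell2_inner_cnj[of "hop c f" g] by simp
qed

lemma ell2_hop_power:
  assumes "f \<in> ell2"
  shows "(hop c ^^ n) f \<in> ell2"
  by (induction n) (auto intro: ell2_hop assms)

lemma ell2_norm_hop_power:
  assumes "f \<in> ell2"
  shows "ell2_norm ((hop c ^^ n) f) \<le> hop_bound c ^ n * ell2_norm f"
proof (induction n)
  case (Suc n)
  have "ell2_norm ((hop c ^^ Suc n) f) \<le> hop_bound c * ell2_norm ((hop c ^^ n) f)"
    by (simp add: ell2_norm_hop ell2_hop_power assms)
  also have "\<dots> \<le> hop_bound c * (hop_bound c ^ n * ell2_norm f)"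
    by (intro mult_left_mono Suc.IH hop_bound_nonneg)
  finally show ?case
    by (simp add: mult.assoc)
qed simp

lemma hop_linear: "hop c (\<lambda>x. a * f x + b * g x) = (\<lambda>x. a * hop c f x + b * hop c g x)"
  by (simp add: hop_def fun_eq_iff sum_distrib_left flip: sum.distrib) (simp add: algebra_simps)

lemma hop_sums:
  assumes "\<And>x. (\<lambda>n. F n x) sums f x"
  shows "(\<lambda>n. hop c (F n) x) sums hop c f x"
  unfolding hop_def by (intro sums_sum sums_add sums_mult assms)

section \<open>Neumann series of the hopping operator\<close>

lemma neumann_summable:
  assumes f: "f \<in> ell2" and w: "hop_bound c < cmod w"
  shows "summable (\<lambda>n. (hop c ^^ n) f x / w ^ Suc n)"
proof (rule summable_comparison_test'[where N = 0])
  have w0: "0 < cmod w"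
    using w hop_bound_nonneg[of c] by linarith
  show "summable (\<lambda>n. (hop_bound c / cmod w) ^ n * (ell2_norm f / cmod w))"
    using w w0 hop_bound_nonneg[of c] by (intro summable_mult2 summable_geometric) simp
  fix n
  have "cmod ((hop c ^^ n) f x) \<le> hop_bound c ^ n * ell2_norm f"
    using cmod_le_ell2_norm[OF ell2_hop_power[OF f]] ell2_norm_hop_power[OF f]
    by (rule order_trans)
  then have "cmod ((hop c ^^ n) f x) / cmod w ^ Suc n \<le> hop_bound c ^ n * ell2_norm f / cmod w ^ Suc n"
    using w0 by (intro divide_right_mono) auto
  then show "norm ((hop c ^^ n) f x / w ^ Suc n) \<le> (hop_bound c / cmod w) ^ n * (ell2_norm f / cmod w)"
    by (simp add: norm_divide norm_mult norm_power power_divide mult.commute)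
qed

text \<open>The candidate for the inverse of \<open>hop c - w\<close> applied to \<open>f\<close>,
  summed pointwise. The sign comes from inverting \<open>hop c - w\<close> rather than
  \<open>w - hop c\<close>.\<close>

definition neumann :: "('d::finite \<Rightarrow> complex) \<Rightarrow> complex \<Rightarrow> (int ^ 'd \<Rightarrow> complex) \<Rightarrow> (int ^ 'd \<Rightarrow> complex)" where
  "neumann c w f = (\<lambda>x. - (\<Sum>n. (hop c ^^ n) f x / w ^ Suc n))"

lemma neumann_sums:
  assumes "f \<in> ell2" "hop_bound c < cmod w"
  shows "(\<lambda>n. - ((hop c ^^ n) f x / w ^ Suc n)) sums neumann c w f x"
  unfolding neumann_def using neumann_summable[OF assms] by (intro sums_minus summable_sums)

text \<open>The partial sums have norms below one fixed geometric sum, so their pointwise limit is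
  square-summable.\<close>

lemma ell2_neumann:
  assumes f: "f \<in> ell2" and w: "hop_bound c < cmod w"
  shows "neumann c w f \<in> ell2"
proof (rule ell2_pointwise_limit)
  let ?r = "hop_bound c / cmod w"
  have w0: "0 < cmod w"
    using w hop_bound_nonneg[of c] by linarith
  have r: "\<bar>?r\<bar> < 1"
    using w w0 hop_bound_nonneg[of c] by simp
  define F where "F = (\<lambda>n x. - (1 / w ^ Suc n) * (hop c ^^ n) f x)"
  have mem: "F n \<in> ell2" for n
    unfolding F_def by (intro ell2_cmult ell2_hop_power f)
  show "(\<lambda>N. \<Sum>n<N. F n x) \<longlonglongrightarrow> neumann c w f x" for x
    using neumann_sums[OF f w, of x] by (simp add: sums_def F_def)
  show "(\<lambda>x. \<Sum>n<N. F n x) \<in> ell2" for N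
    by (intro ell2_sum mem) simp
  fix N
  have "ell2_norm (F n) \<le> ?r ^ n * (ell2_norm f / cmod w)" for n
  proof -
    have "ell2_norm (F n) = ell2_norm ((hop c ^^ n) f) / cmod w ^ Suc n"
      unfolding F_def ell2_norm_cmult by (simp add: norm_divide norm_mult norm_power)
    also have "\<dots> \<le> (hop_bound c ^ n * ell2_norm f) / cmod w ^ Suc n"
      using w0 by (intro divide_right_mono ell2_norm_hop_power f) auto
    finally show ?thesis
      by (simp add: power_divide mult.commute)
  qed
  then have "ell2_norm (\<lambda>x. \<Sum>n<N. F n x) \<le> (\<Sum>n<N. ?r ^ n * (ell2_norm f / cmod w))"
    using ell2_norm_sum[of "{..<N}" F] mem by (meson finite_lessThan order_trans sum_mono)
  also have "\<dots> \<le> (\<Sum>n. ?r ^ n * (ell2_norm f / cmod w))"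
    using r w0 by (intro sum_le_suminf summable_mult2 summable_geometric)
      (auto intro!: mult_nonneg_nonneg divide_nonneg_nonneg ell2_norm_nonneg zero_le_power hop_bound_nonneg)
  finally show "ell2_norm (\<lambda>x. \<Sum>n<N. F n x) \<le> (\<Sum>n. ?r ^ n * (ell2_norm f / cmod w))" .
qed

text \<open>\<open>hop c\<close> acts termwise, being a finite combination of translations, and
  sends term \<open>n\<close> to \<open>w\<close> times term \<open>n + 1\<close>. Hence only term
  \<open>0\<close> survives in the difference.\<close>

lemma hop_neumann:
  assumes f: "f \<in> ell2" and w: "hop_bound c < cmod w"
  shows "hop c (neumann c w f) x - w * neumann c w f x = f x"
proof -
  let ?F = "\<lambda>n x. - ((hop c ^^ n) f x / w ^ Suc n)"
  have w0: "w \<noteq> 0"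
    using w hop_bound_nonneg[of c] by force
  have "(\<lambda>n. hop c (?F n) x) sums hop c (neumann c w f) x"
    by (intro hop_sums neumann_sums f w)
  \<comment> \<open>Homogeneity is the case of \<open>hop_linear\<close> whose second coefficient is
    \<open>0\<close>.\<close>
  moreover have "hop c (?F n) x = w * ?F (Suc n) x" for n
    using hop_linear[of c "- 1 / w ^ Suc n" "(hop c ^^ n) f" 0 "\<lambda>x. 0"] w0
    by (simp add: field_simps fun_eq_iff)
  ultimately have shift: "(\<lambda>n. w * ?F (Suc n) x) sums hop c (neumann c w f) x"
    by simp
  have "(\<lambda>n. w * ?F n x) sums (hop c (neumann c w f) x + w * ?F 0 x)"
    using sums_Suc[OF shift] .
  moreover have "(\<lambda>n. w * ?F n x) sums (w * neumann c w f x)"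
    by (intro sums_mult neumann_sums f w)
  ultimately have "w * neumann c w f x = hop c (neumann c w f) x + w * ?F 0 x"
    by (rule sums_unique2[rotated])
  then show ?thesis
    using w0 by simp
qed

text \<open>Reverse triangle inequality. For \<open>cmod w\<close> above \<open>hop_bound c\<close>
  it yields both injectivity and the bound on the inverse.\<close>

lemma ell2_norm_hop_diff:
  assumes f: "f \<in> ell2"
  shows "(cmod w - hop_bound c) * ell2_norm f \<le> ell2_norm (\<lambda>x. hop c f x - w * f x)"
proof -
  have mem: "(\<lambda>x. - 1 * (hop c f x - w * f x)) \<in> ell2"
    using ell2_add[OF ell2_hop[OF f, of c] ell2_cmult[OF f, of "- w"]] by (intro ell2_cmult) simp
  have "cmod w * ell2_norm f = ell2_norm (\<lambda>x. hop c f x + - 1 * (hop c f x - w * f x))"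
    by (simp flip: ell2_norm_cmult)
  also have "\<dots> \<le> ell2_norm (hop c f) + ell2_norm (\<lambda>x. - 1 * (hop c f x - w * f x))"
    by (intro ell2_norm_add ell2_hop f mem)
  also have "ell2_norm (\<lambda>x. - 1 * (hop c f x - w * f x)) = ell2_norm (\<lambda>x. hop c f x - w * f x)"
    unfolding ell2_norm_cmult by simp
  also have "ell2_norm (hop c f) \<le> hop_bound c * ell2_norm f"
    by (rule ell2_norm_hop[OF f])
  finally show ?thesis
    by (simp add: algebra_simps)
qed

lemma shifted_T0:
  assumes "f \<in> ell2"
  shows "shifted_op (T0 p q \<Phi>) z f =
    (\<lambda>x. hop (alpha q \<Phi>) f x - (z - complex_of_real (a_val p \<Phi>)) * f x)"
  by (simp add: shifted_op_def T0_apply[OF assms] hop_def algebra_simps)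

text \<open>The Neumann series is a right inverse on \<open>ell2\<close> and the lower norm bound
  gives injectivity. So the shifted operator is bijective, its inverse is the Neumann series, and
  the same bound controls the inverse.\<close>

lemma resolvent_T0:
  assumes w: "hop_bound (alpha q \<Phi>) < cmod (z - complex_of_real (a_val p \<Phi>))"
  shows "z \<notin> ell2_spectrum (T0 p q \<Phi>)"
    and "f \<in> ell2 \<Longrightarrow> ell2_resolvent (T0 p q \<Phi>) z f =
      neumann (alpha q \<Phi>) (z - complex_of_real (a_val p \<Phi>)) f"
proof -
  let ?c = "alpha q \<Phi>" and ?w = "z - complex_of_real (a_val p \<Phi>)"
  let ?S = "shifted_op (T0 p q \<Phi>) z"
  have S_ell2: "?S f \<in> ell2" if "f \<in> ell2" for f
    using ell2_add[OF ell2_hop[OF that, of ?c] ell2_cmult[OF that, of "- ?w"]]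
    unfolding shifted_T0[OF that] by (simp add: algebra_simps)
  have S_neumann: "?S (neumann ?c ?w f) = f" if "f \<in> ell2" for f
    by (simp add: shifted_T0 ell2_neumann that w hop_neumann fun_eq_iff)
  have inj: "inj_on ?S ell2"
  proof (rule inj_onI)
    fix f g assume f: "f \<in> ell2" and g: "g \<in> ell2" and eq: "?S f = ?S g"
    have d: "(\<lambda>x. f x - g x) \<in> ell2"
      using ell2_add[OF f ell2_cmult[OF g, of "- 1"]] by simp
    have "hop ?c (\<lambda>x. f x - g x) x - ?w * (f x - g x) = 0" for x
      using fun_cong[OF eq, of x] hop_linear[of ?c 1 f "- 1" g]
      by (simp add: shifted_T0 f g algebra_simps)
    then have "(cmod ?w - hop_bound ?c) * ell2_norm (\<lambda>x. f x - g x) \<le> 0"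
      using ell2_norm_hop_diff[OF d, of ?w ?c] by simp
    then have "ell2_norm (\<lambda>x. f x - g x) = 0"
      using w ell2_norm_nonneg[of "\<lambda>x. f x - g x"] by (simp add: mult_le_0_iff)
    then show "f = g"
      using ell2_norm_eq_0[OF d] by (simp add: fun_eq_iff)
  qed
  show R: "ell2_resolvent (T0 p q \<Phi>) z f = neumann ?c ?w f" if "f \<in> ell2" for f
    unfolding ell2_resolvent_def
    using inv_into_f_f[OF inj ell2_neumann[OF that w]] S_neumann[OF that] by simp
  have "ell2 \<subseteq> ?S ` ell2"
    using S_neumann ell2_neumann[OF _ w] by (metis image_eqI subsetI)
  then have "bij_betw ?S ell2 ell2"
    using inj S_ell2 by (simp add: bij_betw_def image_subsetI subset_antisym)
  moreover have "ell2_norm (ell2_resolvent (T0 p q \<Phi>) z f)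
      \<le> 1 / (cmod ?w - hop_bound ?c) * ell2_norm f" if "f \<in> ell2" for f
  proof -
    have "(cmod ?w - hop_bound ?c) * ell2_norm (neumann ?c ?w f) \<le> ell2_norm f"
      using ell2_norm_hop_diff[OF ell2_neumann[OF that w], of ?w ?c] by (simp add: hop_neumann that w)
    then show ?thesis
      using w by (simp add: R that pos_le_divide_eq mult.commute)
  qed
  ultimately show "z \<notin> ell2_spectrum (T0 p q \<Phi>)"
    unfolding ell2_spectrum_def by blast
qed


section \<open>Moments of a function of odd parity\<close>

definition odd_supported :: "(int ^ 'd \<Rightarrow> complex) \<Rightarrow> bool" where
  "odd_supported f \<longleftrightarrow> (\<forall>x. even (\<Sum>j\<in>UNIV. x $ j) \<longrightarrow> f x = 0)"

lemma sum_axis: "(\<Sum>i\<in>UNIV. (axis j a :: int ^ 'd::finite) $ i) = a"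
  by (simp add: axis_def)

text \<open>Each application of \<open>hop\<close> moves by one unit step and so flips the parity of
  the coordinate sum. The absolute value and \<open>nat\<close> only put that parity into a natural
  number.\<close>

lemma hop_power_parity:
  assumes "odd_supported f" "even (n + nat \<bar>\<Sum>j\<in>UNIV. x $ j\<bar>)"
  shows "(hop c ^^ n) f x = 0"
  using assms(2)
proof (induction n arbitrary: x)
  case 0
  then show ?case
    using assms(1) by (simp add: odd_supported_def even_nat_iff)
next
  case (Suc n)
  have "(hop c ^^ n) f (x + axis j 1) = 0" "(hop c ^^ n) f (x - axis j 1) = 0" for j
    using Suc.prems by (intro Suc.IH; simp add: sum.distrib sum_subtractf sum_axis even_nat_iff)+
  then show ?case
    by (simp add: hop_def[of c "(hop c ^^ n) f"])
qed

text \<open>The case split builds in realness, nonnegativity and the vanishing of odd moments. The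
  agreement with the inner products of \<open>f\<close> and \<open>(hop c ^^ n) f\<close> is proved
  next for \<open>odd_supported\<close> functions.\<close>

definition moment :: "('d::finite \<Rightarrow> complex) \<Rightarrow> (int ^ 'd \<Rightarrow> complex) \<Rightarrow> nat \<Rightarrow> real" where
  "moment c f n = (if even n then (ell2_norm ((hop c ^^ (n div 2)) f))\<^sup>2 else 0)"

text \<open>For \<open>n = k + k\<close>, symmetry moves \<open>k\<close> factors to the left
  argument. For odd \<open>n\<close> the two functions live on different sublattices.\<close>

lemma ell2_inner_hop_power:
  assumes f: "f \<in> ell2" and odd_supp: "odd_supported f"
  shows "ell2_inner f ((hop c ^^ n) f) = complex_of_real (moment c f n)"
proof (cases "even n")
  case True
  have shift: "ell2_inner f ((hop c ^^ k) g) = ell2_inner ((hop c ^^ k) f) g" if "g \<in> ell2" for k g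
    using that
  proof (induction k arbitrary: g)
    case (Suc k)
    have "ell2_inner f ((hop c ^^ Suc k) g) = ell2_inner ((hop c ^^ k) f) (hop c g)"
      using Suc.IH[OF ell2_hop[OF Suc.prems]] by (simp add: funpow_swap1)
    then show ?case
      by (simp add: ell2_inner_hop ell2_hop_power f Suc.prems)
  qed simp
  obtain k where n: "n = k + k"
    using True by (metis evenE mult_2)
  show ?thesis
    unfolding n funpow_add comp_def shift[OF ell2_hop_power[OF f]]
    by (simp add: ell2_inner_self ell2_hop_power f moment_def flip: mult_2)
next
  case False
  have "cnj (f x) * (hop c ^^ n) f x = 0" for x
    using odd_supp hop_power_parity[OF odd_supp, of n x c] False
    by (auto simp: odd_supported_def even_nat_iff)
  then have "ell2_inner f ((hop c ^^ n) f) = 0"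
    by (simp only: ell2_inner_def infsum_0)
  then show ?thesis
    using False by (simp add: moment_def)
qed

lemma moment_nonneg: "0 \<le> moment c f n"
  by (simp add: moment_def)

lemma moment_le:
  assumes "f \<in> ell2"
  shows "moment c f n \<le> (if even n then hop_bound c ^ n * (ell2_norm f)\<^sup>2 else 0)"
proof (cases "even n")
  case True
  then obtain k where n: "n = 2 * k" ..
  have "(ell2_norm ((hop c ^^ k) f))\<^sup>2 \<le> (hop_bound c ^ k * ell2_norm f)\<^sup>2"
    by (intro power_mono ell2_norm_hop_power assms ell2_norm_nonneg)
  then show ?thesis
    by (simp add: moment_def n power_mult_distrib mult.commute flip: power_mult)
qed (simp add: moment_def)

text \<open>A power series in \<open>1 / s\<close> with one factor \<open>1 / s\<close> split off, a
  form to which continuity of power series applies.\<close>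

definition moment_series :: "('d::finite \<Rightarrow> complex) \<Rightarrow> (int ^ 'd \<Rightarrow> complex) \<Rightarrow> real \<Rightarrow> real" where
  "moment_series c f s = (\<Sum>n. moment c f n * (1 / s) ^ n) / s"

text \<open>The average of the geometric series for \<open>r\<close> and \<open>- r\<close>.\<close>

lemma sums_even_geometric:
  fixes r :: real
  assumes "\<bar>r\<bar> < 1"
  shows "(\<lambda>n. if even n then r ^ n else 0) sums (1 / (1 - r\<^sup>2))"
proof -
  have "(\<lambda>n. (r ^ n + (- r) ^ n) / 2) sums ((1 / (1 - r) + 1 / (1 - (- r))) / 2)"
    using assms by (intro sums_divide sums_add geometric_sums) auto
  moreover have "(r ^ n + (- r) ^ n) / 2 = (if even n then r ^ n else 0)" for n
    by simp
  moreover have "(1 / (1 - r) + 1 / (1 - (- r))) / 2 = 1 / (1 - r\<^sup>2)"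
  proof -
    have "1 - r \<noteq> 0" "1 + r \<noteq> 0" "1 - r\<^sup>2 = (1 - r) * (1 + r)"
      using assms by (auto simp: power2_eq_square algebra_simps)
    then show ?thesis
      by (simp add: divide_simps)
  qed
  ultimately show ?thesis
    by (simp only:)
qed

lemma moment_term_le:
  assumes f: "f \<in> ell2" and s: "0 < s"
  shows "moment c f n * (1 / s) ^ n \<le> (ell2_norm f)\<^sup>2 * (if even n then (hop_bound c / s) ^ n else 0)"
proof -
  have "moment c f n * (1 / s) ^ n
      \<le> (if even n then hop_bound c ^ n * (ell2_norm f)\<^sup>2 else 0) * (1 / s) ^ n"
    using s by (intro mult_right_mono moment_le f) auto
  then show ?thesis
    by (auto simp: power_divide mult.commute split: if_splits)
qed

lemma moment_summable:
  assumes f: "f \<in> ell2" and s: "hop_bound c < s"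
  shows "summable (\<lambda>n. moment c f n * (1 / s) ^ n)"
proof (rule summable_comparison_test'[where N = 0])
  have s0: "0 < s"
    using s hop_bound_nonneg[of c] by simp
  then have "\<bar>hop_bound c / s\<bar> < 1"
    using s hop_bound_nonneg[of c] by simp
  then show "summable (\<lambda>n. (ell2_norm f)\<^sup>2 * (if even n then (hop_bound c / s) ^ n else 0))"
    by (intro summable_mult sums_summable[OF sums_even_geometric])
  show "norm (moment c f n * (1 / s) ^ n)
      \<le> (ell2_norm f)\<^sup>2 * (if even n then (hop_bound c / s) ^ n else 0)" for n
    using moment_term_le[OF f s0] s0 by (simp add: abs_mult moment_nonneg)
qed

text \<open>All terms are nonnegative, and the term \<open>n = 0\<close> alone gives the
  bound.\<close>

lemma moment_series_ge:
  assumes f: "f \<in> ell2" and s: "hop_bound c < s"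
  shows "(ell2_norm f)\<^sup>2 / s \<le> moment_series c f s"
proof -
  have s0: "0 < s"
    using s hop_bound_nonneg[of c] by simp
  have "(\<Sum>n\<in>{0}. moment c f n * (1 / s) ^ n) \<le> (\<Sum>n. moment c f n * (1 / s) ^ n)"
    using s0 by (intro sum_le_suminf moment_summable f s) (auto simp: moment_nonneg)
  then show ?thesis
    using s0 unfolding moment_series_def by (intro divide_right_mono) (auto simp: moment_def)
qed

text \<open>The moment bounds dominate the series by a geometric series in
  \<open>(hop_bound c / s)\<^sup>2\<close>.\<close>

lemma moment_series_le:
  assumes f: "f \<in> ell2" and s: "hop_bound c < s"
  shows "moment_series c f s \<le> (ell2_norm f)\<^sup>2 * s / (s\<^sup>2 - (hop_bound c)\<^sup>2)"
proof -
  have s0: "0 < s"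
    using s hop_bound_nonneg[of c] by simp
  then have "\<bar>hop_bound c / s\<bar> < 1"
    using s hop_bound_nonneg[of c] by simp
  from sums_mult[OF sums_even_geometric[OF this], of "(ell2_norm f)\<^sup>2"]
  have "(\<Sum>n. moment c f n * (1 / s) ^ n) \<le> (ell2_norm f)\<^sup>2 * (1 / (1 - (hop_bound c / s)\<^sup>2))"
    using moment_term_le[OF f s0] moment_summable[OF f s]
    by (metis (no_types, lifting) sums_le summable_sums)
  then have "moment_series c f s \<le> (ell2_norm f)\<^sup>2 * (1 / (1 - (hop_bound c / s)\<^sup>2)) / s"
    using s0 unfolding moment_series_def by (intro divide_right_mono) auto
  also have "1 - (hop_bound c / s)\<^sup>2 = (s\<^sup>2 - (hop_bound c)\<^sup>2) / s\<^sup>2"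
    using s0 by (simp add: field_simps)
  finally show ?thesis
    using s0 by (simp add: power2_eq_square)
qed

lemma isCont_moment_series:
  assumes f: "f \<in> ell2" and s: "hop_bound c < s"
  shows "isCont (moment_series c f) s"
proof -
  \<comment> \<open>Convergence at \<open>1 / r\<close> puts \<open>1 / s\<close> strictly inside
    the disc of convergence.\<close>
  obtain r where r: "hop_bound c < r" "r < s"
    using s dense by blast
  have r0: "0 < r"
    using r hop_bound_nonneg[of c] by simp
  have "norm (1 / s) < norm (1 / r)"
    using r r0 by (simp add: frac_less2)
  then have "isCont (\<lambda>z. \<Sum>n. moment c f n * z ^ n) (1 / s)"
    by (rule isCont_powser[OF moment_summable[OF f r(1)]])
  moreover have "isCont (\<lambda>s. 1 / s) s"
    using r r0 by (intro continuous_intros) auto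
  ultimately have "isCont (\<lambda>s. \<Sum>n. moment c f n * (1 / s) ^ n) s"
    using isCont_o2[of s "\<lambda>s. 1 / s" "\<lambda>z. \<Sum>n. moment c f n * z ^ n"] by blast
  then have "isCont (\<lambda>s. (\<Sum>n. moment c f n * (1 / s) ^ n) / s) s"
    using r r0 by (intro isCont_divide) auto
  then show ?thesis
    unfolding moment_series_def[abs_def] .
qed

text \<open>Only even powers occur in the sum, so the outer division by \<open>s\<close> makes the
  function odd.\<close>

lemma moment_series_minus: "moment_series c f (- s) = - moment_series c f s"
proof -
  have "moment c f n * (1 / - s) ^ n = moment c f n * (1 / s) ^ n" for n
    by (cases "even n") (simp_all add: moment_def power_divide)
  then have "(\<Sum>n. moment c f n * (1 / - s) ^ n) = (\<Sum>n. moment c f n * (1 / s) ^ n)"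
    by presburger
  then show ?thesis
    unfolding moment_series_def by simp
qed

lemma ell2_inner_neumann:
  fixes t :: real
  assumes f: "f \<in> ell2" and odd_supp: "odd_supported f"
    and fin: "finite F" "\<And>x. x \<notin> F \<Longrightarrow> f x = 0"
    and t: "hop_bound c < \<bar>t\<bar>"
  shows "ell2_inner f (neumann c (complex_of_real t) f) = - complex_of_real (moment_series c f t)"
proof -
  let ?w = "complex_of_real t"
  have "(\<lambda>n. \<Sum>x\<in>F. cnj (f x) * - ((hop c ^^ n) f x / ?w ^ Suc n))
      sums (\<Sum>x\<in>F. cnj (f x) * neumann c ?w f x)"
    using f t by (intro sums_sum sums_mult neumann_sums) auto
  moreover have "(\<Sum>x\<in>F. cnj (f x) * - ((hop c ^^ n) f x / ?w ^ Suc n))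
      = complex_of_real (- (moment c f n * (1 / t) ^ n / t))" for n
  proof -
    have "(\<Sum>x\<in>F. cnj (f x) * - ((hop c ^^ n) f x / ?w ^ Suc n))
        = - (ell2_inner f ((hop c ^^ n) f) / ?w ^ Suc n)"
      by (simp add: ell2_inner_finite_support[OF fin] sum_negf sum_divide_distrib)
    then show ?thesis
      by (simp add: ell2_inner_hop_power[OF f odd_supp] power_divide mult.commute)
  qed
  ultimately have "(\<lambda>n. complex_of_real (- (moment c f n * (1 / t) ^ n / t)))
      sums ell2_inner f (neumann c ?w f)"
    by (simp add: ell2_inner_finite_support[OF fin])
  moreover have "(\<lambda>n. complex_of_real (- (moment c f n * (1 / t) ^ n / t)))
      sums complex_of_real (- moment_series c f t)"
  proof -
    \<comment> \<open>Negative \<open>t\<close> is covered through its absolute value, again because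
      only even powers occur.\<close>
    have "summable (\<lambda>n. moment c f n * (1 / \<bar>t\<bar>) ^ n)"
      by (rule moment_summable[OF f t])
    moreover have "moment c f n * (1 / \<bar>t\<bar>) ^ n = moment c f n * (1 / t) ^ n" for n
      by (cases "even n") (simp_all add: moment_def power_divide power_even_abs)
    ultimately have "summable (\<lambda>n. moment c f n * (1 / t) ^ n)"
      by simp
    then show ?thesis
      unfolding moment_series_def by (intro sums_of_real sums_minus sums_divide summable_sums)
  qed
  ultimately show ?thesis
    by (metis sums_unique2 of_real_minus)
qed

text \<open>Intermediate values for \<open>moment_series c f s - (s + \<beta>)\<close>:
  \<open>lower\<close> makes it nonnegative just above \<open>hop_bound c\<close>, and
  \<open>upper\<close> makes it nonpositive at \<open>r\<close>.\<close>

lemma moment_series_crossing: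
  assumes f: "f \<in> ell2" and r: "hop_bound c \<le> r" and rb: "0 \<le> r + \<beta>"
    and lower: "hop_bound c * (hop_bound c + \<beta>) < (ell2_norm f)\<^sup>2"
    and upper: "(ell2_norm f)\<^sup>2 \<le> (r + \<beta>) * ((r\<^sup>2 - (hop_bound c)\<^sup>2) / r)"
  obtains s where "hop_bound c < s" "s \<le> r" "moment_series c f s = s + \<beta>"
proof -
  let ?b = "hop_bound c" and ?N = "(ell2_norm f)\<^sup>2"
  have b0: "0 \<le> ?b"
    by (rule hop_bound_nonneg)
  \<comment> \<open>If \<open>r = ?b\<close>, the right side of \<open>upper\<close> is
    \<open>0\<close>, also for \<open>r = 0\<close> because \<open>x / 0 = 0\<close>. But
    \<open>rb\<close> makes the left side of \<open>lower\<close> nonnegative, a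
    contradiction.\<close>
  have br: "?b < r"
  proof (rule ccontr)
    assume "\<not> ?b < r"
    then have "r = ?b"
      using r by simp
    then have "?N \<le> 0" "0 \<le> ?b * (?b + \<beta>)"
      using upper rb b0 by auto
    then show False
      using lower by simp
  qed
  then have r0: "0 < r"
    using b0 by simp
  have r2: "0 < r\<^sup>2 - ?b\<^sup>2"
    using br b0 by (simp add: power_strict_mono)
  \<comment> \<open>The estimates on the series need \<open>s\<close> strictly above
    \<open>?b\<close>, so the strict inequality \<open>lower\<close> is carried to a nearby point
    \<open>s0\<close> by continuity.\<close>
  have "((\<lambda>s. s * (s + \<beta>)) \<longlongrightarrow> ?b * (?b + \<beta>)) (at_right ?b)"
    by (intro tendsto_intros)
  then have "eventually (\<lambda>s. s * (s + \<beta>) < ?N) (at_right ?b)"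
    using lower by (rule order_tendstoD)
  moreover have "eventually (\<lambda>s. s \<in> {?b<..<r}) (at_right ?b)"
    using br by (rule eventually_at_right_real)
  ultimately have "eventually (\<lambda>s. s * (s + \<beta>) < ?N \<and> s \<in> {?b<..<r}) (at_right ?b)"
    by (rule eventually_conj)
  then obtain s0 where s0: "s0 * (s0 + \<beta>) < ?N" "?b < s0" "s0 < r"
    using eventually_happens[of _ "at_right ?b"] by auto
  have "s0 + \<beta> \<le> ?N / s0"
    using s0 b0 by (simp add: field_simps)
  then have low: "s0 + \<beta> \<le> moment_series c f s0"
    using moment_series_ge[OF f s0(2)] by simp
  have "?N * r / (r\<^sup>2 - ?b\<^sup>2) \<le> r + \<beta>"
    using upper r0 r2 by (simp add: field_simps)
  then have high: "moment_series c f r \<le> r + \<beta>"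
    using moment_series_le[OF f br] by simp
  have "\<exists>s\<ge>s0. s \<le> r \<and> moment_series c f s - (s + \<beta>) = 0"
  proof (rule IVT2')
    show "continuous_on {s0..r} (\<lambda>s. moment_series c f s - (s + \<beta>))"
      using s0 by (intro continuous_at_imp_continuous_on ballI continuous_intros isCont_moment_series f) auto
  qed (use low high s0 in auto)
  then show ?thesis
    using that s0 by (metis eq_iff_diff_eq_0 less_le_trans)
qed


section \<open>Bounds on the parameters and the function \<open>f\<close>\<close>

lemma Re_sigma3: "Re (vec_inner u (sigma3 *v u)) = (cmod (u $ 1))\<^sup>2 - (cmod (u $ 2))\<^sup>2"
  unfolding cmod_power2
  by (simp add: vec_inner_def sigma3_def matrix_vector_mult_def sum_2 vector_2 power2_eq_square)

lemma norm_eq_1_sum: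
  fixes V :: "complex ^ 2 ^ 'd::finite"
  assumes "norm V = 1"
  shows "(\<Sum>j\<in>UNIV. (cmod (V $ j $ 1))\<^sup>2 + (cmod (V $ j $ 2))\<^sup>2) = 1"
proof -
  have "(norm V)\<^sup>2 = (\<Sum>j\<in>UNIV. (norm (V $ j))\<^sup>2)"
    by (simp add: norm_vec_def L2_set_def sum_nonneg)
  also have "\<dots> = (\<Sum>j\<in>UNIV. (cmod (V $ j $ 1))\<^sup>2 + (cmod (V $ j $ 2))\<^sup>2)"
    by (intro sum.cong refl) (simp add: norm_vec_def L2_set_def sum_2)
  finally show ?thesis
    using assms by simp
qed

text \<open>Applied to \<Phi> with both signs \<open>e\<close>, this puts the interval of radius
  \<open>lambda_val q \<Phi>\<close> around \<open>a_val p \<Phi>\<close> inside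
  \<open>[-1, 1]\<close>. Applied to \<Omega>, it bounds \<open>a_val p \<Omega>\<close> by
  \<open>1\<close> in absolute value.\<close>

lemma lambda_val_le:
  assumes V: "norm V = 1" and pq: "(p, q) \<in> param_set" and e: "e = 1 \<or> e = - 1"
  shows "lambda_val q V \<le> 1 + e * a_val p V"
proof -
  have "lambda_val q V = (\<Sum>j\<in>UNIV. 2 * cmod (alpha q V j))"
    by (simp add: lambda_val_def sum_distrib_left)
  also have "\<dots> \<le> (\<Sum>j\<in>UNIV. (cmod (V $ j $ 1))\<^sup>2 + (cmod (V $ j $ 2))\<^sup>2
      + e * (p $ j * ((cmod (V $ j $ 1))\<^sup>2 - (cmod (V $ j $ 2))\<^sup>2)))"
  proof (rule sum_mono)
    fix j
    define a b where "a = cmod (V $ j $ 1)" and "b = cmod (V $ j $ 2)"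
    define P where "P = e * p $ j"
    have q: "(cmod (q $ j))\<^sup>2 = (1 + P) * (1 - P)"
      using pq e by (auto simp: param_set_def P_def power2_eq_square algebra_simps)
    have "P\<^sup>2 \<le> 1"
      using q zero_le_power2[of "cmod (q $ j)"] by (simp only: power2_eq_square algebra_simps)
    then have P: "0 \<le> 1 + P" "0 \<le> 1 - P"
      using abs_square_le_1[of P] by auto
    then have cq: "cmod (q $ j) = sqrt (1 + P) * sqrt (1 - P)"
      using real_sqrt_unique[OF q] by (simp add: real_sqrt_mult)
    \<comment> \<open>The inequality between arithmetic and geometric means for
      \<open>(1 + P) * a\<^sup>2\<close> and \<open>(1 - P) * b\<^sup>2\<close>, whose product
      contains \<open>(cmod (q $ j))\<^sup>2\<close>.\<close>
    have "0 \<le> (sqrt (1 + P) * a - sqrt (1 - P) * b)\<^sup>2"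
      by simp
    also have "\<dots> = (1 + P) * a\<^sup>2 + (1 - P) * b\<^sup>2 - 2 * (sqrt (1 + P) * sqrt (1 - P) * a * b)"
      using P by (simp add: power2_diff power_mult_distrib)
    finally show "2 * cmod (alpha q V j) \<le> (cmod (V $ j $ 1))\<^sup>2 + (cmod (V $ j $ 2))\<^sup>2
      + e * (p $ j * ((cmod (V $ j $ 1))\<^sup>2 - (cmod (V $ j $ 2))\<^sup>2))"
      by (simp add: alpha_def norm_mult cq algebra_simps P_def flip: a_def b_def)
  qed
  also have "\<dots> = 1 + e * a_val p V"
    using norm_eq_1_sum[OF V]
    by (simp add: sum.distrib a_val_def Re_sigma3 sum_distrib_left)
  finally show ?thesis .
qed

lemma odd_supported_phi_q: "odd_supported (phi_q q \<Phi> \<Omega>)"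
  unfolding odd_supported_def
proof (intro allI impI)
  fix x :: "int ^ 'a" assume "even (\<Sum>j\<in>UNIV. x $ j)"
  then have "x \<noteq> axis j 1" "x \<noteq> - axis j 1" for j
    using sum_axis[of j 1] by (auto simp: sum_negf)
  then show "phi_q q \<Phi> \<Omega> x = 0"
    by (simp add: phi_q_def)
qed

text \<open>Subtracting \<open>a_val p \<Phi>\<close> from the spectral parameter turns the
  resolvent of \<open>T0\<close> into the Neumann series of \<open>hop\<close>, and
  \<open>phi_q\<close> has the finite support that its pairing requires.\<close>

lemma f_fun_eq:
  assumes "hop_bound (alpha q \<Phi>) < \<bar>t - a_val p \<Phi>\<bar>"
  shows "f_fun p q \<Phi> \<Omega> t =
    t - a_val p \<Omega> - moment_series (alpha q \<Phi>) (phi_q q \<Phi> \<Omega>) (t - a_val p \<Phi>)"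
proof -
  let ?F = "range (\<lambda>j. axis j 1) \<union> range (\<lambda>j. - axis j 1) :: (int ^ 'a) set"
  have "phi_q q \<Phi> \<Omega> x = 0" if "x \<notin> ?F" for x
  proof -
    have "x \<noteq> axis j 1" "x \<noteq> - axis j 1" for j
      using that by auto
    then show ?thesis
      by (simp add: phi_q_def)
  qed
  then have "ell2_inner (phi_q q \<Phi> \<Omega>)
      (neumann (alpha q \<Phi>) (complex_of_real (t - a_val p \<Phi>)) (phi_q q \<Phi> \<Omega>))
      = - complex_of_real (moment_series (alpha q \<Phi>) (phi_q q \<Phi> \<Omega>) (t - a_val p \<Phi>))"
    by (intro ell2_inner_neumann[where F = ?F] ell2_phi_q odd_supported_phi_q assms) auto
  moreover have "hop_bound (alpha q \<Phi>) < cmod (complex_of_real t - complex_of_real (a_val p \<Phi>))"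
    using assms by (simp flip: of_real_diff)
  ultimately show ?thesis
    by (simp add: f_fun_def resolvent_T0(2) ell2_phi_q)
qed

lemma f_dom_I:
  assumes "hop_bound (alpha q \<Phi>) < \<bar>t - a_val p \<Phi>\<bar>" "t \<in> {-1..1}"
  shows "t \<in> f_dom p q \<Phi>"
proof -
  have "hop_bound (alpha q \<Phi>) < cmod (complex_of_real t - complex_of_real (a_val p \<Phi>))"
    using assms by (simp flip: of_real_diff)
  then show ?thesis
    using assms by (simp add: f_dom_def resolvent_T0(1))
qed

theorem theorem3p5:
  fixes \<Phi> \<Omega> :: "complex ^ 2 ^ ('d::finite)" and l :: 'd
    and p :: "real ^ 'd" and q :: "complex ^ 'd"
  assumes "norm \<Phi> = 1" and "norm \<Omega> = 1"
    and "\<And>j. vec_dot (\<Phi> $ j) (sigma1 *v (\<Omega> $ j)) = 0"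
    and "vec_inner (\<Phi> $ l) (sigma_plus *v (\<Omega> $ l)) \<noteq> 0"
    and "(p, q) \<in> param_set_at l"
  shows "(lambda_val q \<Phi> * (lambda_val q \<Phi> + a_val p \<Omega> - a_val p \<Phi>) < (ell2_norm (phi_q q \<Phi> \<Omega>))\<^sup>2
       \<and> (ell2_norm (phi_q q \<Phi> \<Omega>))\<^sup>2
           \<le> (1 + a_val p \<Omega>) * (((1 + a_val p \<Phi>)\<^sup>2 - (lambda_val q \<Phi>)\<^sup>2) / (1 + a_val p \<Phi>))
       \<longrightarrow> (\<exists>t \<in> T_minus p q \<Phi>. t \<in> f_dom p q \<Phi> \<and> f_fun p q \<Phi> \<Omega> t = 0))
    \<and> (lambda_val q \<Phi> * (lambda_val q \<Phi> - a_val p \<Omega> + a_val p \<Phi>) < (ell2_norm (phi_q q \<Phi> \<Omega>))\<^sup>2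
       \<and> (ell2_norm (phi_q q \<Phi> \<Omega>))\<^sup>2
           \<le> (1 - a_val p \<Omega>) * (((1 - a_val p \<Phi>)\<^sup>2 - (lambda_val q \<Phi>)\<^sup>2) / (1 - a_val p \<Phi>))
       \<longrightarrow> (\<exists>t \<in> T_plus p q \<Phi>. t \<in> f_dom p q \<Phi> \<and> f_fun p q \<Phi> \<Omega> t = 0))"
proof -
  let ?L = "lambda_val q \<Phi>" and ?a = "a_val p \<Phi>" and ?b = "a_val p \<Omega>"
  let ?f = "phi_q q \<Phi> \<Omega>" and ?c = "alpha q \<Phi>"
  have L: "hop_bound ?c = ?L"
    by (simp add: hop_bound_def lambda_val_def)
  have L0: "0 \<le> ?L" "0 \<le> lambda_val q \<Omega>"
    by (simp_all add: lambda_val_def sum_nonneg)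
  have pq: "(p, q) \<in> param_set"
    using assms(5) by (simp add: param_set_at_def)
  have a: "?L \<le> 1 + ?a" "?L \<le> 1 - ?a"
    using lambda_val_le[OF assms(1) pq, of 1] lambda_val_le[OF assms(1) pq, of "- 1"] by simp_all
  \<comment> \<open>These become the condition \<open>0 \<le> r + \<beta>\<close> of the crossing
    lemma in the two cases.\<close>
  have b: "0 \<le> 1 + ?b" "0 \<le> 1 - ?b"
    using lambda_val_le[OF assms(2) pq, of 1] lambda_val_le[OF assms(2) pq, of "- 1"] L0 by simp_all
  show ?thesis
  proof (intro conjI impI; elim conjE)
    assume lower: "?L * (?L + ?b - ?a) < (ell2_norm ?f)\<^sup>2"
      and upper: "(ell2_norm ?f)\<^sup>2 \<le> (1 + ?b) * (((1 + ?a)\<^sup>2 - ?L\<^sup>2) / (1 + ?a))"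
    \<comment> \<open>With \<open>t = ?a - s\<close>, the endpoint \<open>s = 1 + ?a\<close> is
      \<open>t = -1\<close>, and \<open>s > ?L\<close> says that \<open>t\<close> lies below the
      spectral interval.\<close>
    obtain s where s: "?L < s" "s \<le> 1 + ?a" "moment_series ?c ?f s = s + (?b - ?a)"
      by (rule moment_series_crossing[of ?f ?c "1 + ?a" "?b - ?a", unfolded L])
        (use a b lower upper ell2_phi_q in \<open>auto simp: algebra_simps\<close>)
    \<comment> \<open>The series is evaluated at \<open>- s\<close>, and oddness turns the crossing
      equation into a zero.\<close>
    have "f_fun p q \<Phi> \<Omega> (?a - s) = 0"
      using f_fun_eq[of q \<Phi> "?a - s" p \<Omega>] s L0 by (simp add: L moment_series_minus)
    moreover have "?a - s \<in> f_dom p q \<Phi>"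
      using s a L0 by (intro f_dom_I) (auto simp: L)
    ultimately show "\<exists>t\<in>T_minus p q \<Phi>. t \<in> f_dom p q \<Phi> \<and> f_fun p q \<Phi> \<Omega> t = 0"
      using s by (intro bexI[of _ "?a - s"]) (auto simp: T_minus_def)
  next
    assume lower: "?L * (?L - ?b + ?a) < (ell2_norm ?f)\<^sup>2"
      and upper: "(ell2_norm ?f)\<^sup>2 \<le> (1 - ?b) * (((1 - ?a)\<^sup>2 - ?L\<^sup>2) / (1 - ?a))"
    \<comment> \<open>The mirror image: now \<open>t = ?a + s\<close>, the endpoint is
      \<open>t = 1\<close>, and \<open>?a\<close> and \<open>?b\<close> change sign.\<close>
    obtain s where s: "?L < s" "s \<le> 1 - ?a" "moment_series ?c ?f s = s + (?a - ?b)"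
      by (rule moment_series_crossing[of ?f ?c "1 - ?a" "?a - ?b", unfolded L])
        (use a b lower upper ell2_phi_q in \<open>auto simp: algebra_simps\<close>)
    have "f_fun p q \<Phi> \<Omega> (?a + s) = 0"
      using f_fun_eq[of q \<Phi> "?a + s" p \<Omega>] s L0 by (simp add: L)
    moreover have "?a + s \<in> f_dom p q \<Phi>"
      using s a L0 by (intro f_dom_I) (auto simp: L)
    ultimately show "\<exists>t\<in>T_plus p q \<Phi>. t \<in> f_dom p q \<Phi> \<and> f_fun p q \<Phi> \<Omega> t = 0"
      using s by (intro bexI[of _ "?a + s"]) (auto simp: T_plus_def)
  qed
qed

end
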